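(* For every set of formulas $\Theta\subseteq\mathrm{Form}$, $\Theta^\vdash=\Theta^\models$.
   Context: Formulas: $\mathrm{Form}$ is the least set containing a fixed countably infinite set of propositional variables and closed under $\alpha\to\beta$, $\neg\alpha$, and $\delta(\langle\alpha_i\rangle)$ for every sequence $\langle\alpha_i\rangle=\alpha_1,\alpha_2,\dots$ indexed by $\omega$. Notation: $\langle\alpha\rangle$ is the constant sequence of value $\alpha$; $\alpha,\langle\beta_i\rangle$ is $\alpha,\beta_1,\beta_2,\dots$; $\langle\alpha_i\rangle_{i>1}$ is $\alpha_2,\alpha_3,\dots$; $\tfrac12\alpha:=\delta(\alpha,\langle\neg(\alpha\to\alpha)\rangle)$; a schema $\alpha\leftrightarrow\beta$ stands for the two schemas $\alpha\to\beta$ and $\beta\to\alpha$. The calculus $\mathcal{L}_\Delta$ has axiom schemata: (Ł1) $\alpha\to(\beta\to\alpha)$; (Ł2) $(\alpha\to\beta)\to((\beta\to\gamma)\to(\alpha\to\gamma))$; (Ł3) $((\alpha\to\beta)\to\beta)\to((\beta\to\alpha)\to\alpha)$; (Ł4) $(\neg\alpha\to\neg\beta)\to(\beta\to\alpha)$; (Δ1) $\neg(\delta(\langle\alpha_i\rangle)\to\tfrac12\alpha_1)\leftrightarrow\tfrac12\delta(\langle\alpha_i\rangle_{i>1})$; (Δ2) $\tfrac12\delta(\langle\alpha_i\rangle)\leftrightarrow\delta(\langle\tfrac12\alpha_i\rangle)$; (Δ3) $\delta(\langle\alpha\rangle)\leftrightarrow\alpha$; (Δ4) $\tfrac12\delta(\langle\alpha_i\rangle)\leftrightarrow\delta(\neg(\alpha\to\alpha),\langle\alpha_i\rangle)$;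 (Δ5) $\delta(\langle\alpha_i\rangle)\to\delta(\langle\neg\alpha_i\to\beta_i\rangle)$; (Δ6) $\tfrac12\neg(\alpha\to\beta)\leftrightarrow\neg(\tfrac12\alpha\to\tfrac12\beta)$; (Δ7) $\delta(\langle\alpha_i\to\beta_i\rangle)\to(\delta(\langle\alpha_i\rangle)\to\delta(\langle\beta_i\rangle))$. Rules: Modus Ponens and the $\delta$-rule (from $\alpha_i$ for all $i\in\omega$ infer $\delta(\langle\alpha_i\rangle)$). A proof of $\alpha$ from $\Theta$ is a sequence $(\alpha_i)_{i\in\eta+1}$ indexed by a successor ordinal with $\eta$ countable, $\alpha_\eta=\alpha$, each member an axiom, an element of $\Theta$, or obtained from earlier members by a rule. $\Theta^\vdash$ is the set of formulas provable from $\Theta$. Semantics: a valuation is a map $f\colon\mathrm{Form}\to[0,1]$ with $f(\neg\alpha)=1-f(\alpha)$, $f(\alpha\to\beta)=\min\{1,1-f(\alpha)+f(\beta)\}$, $f(\delta(\langle\alpha_i\rangle))=\sum_{i\ge1}f(\alpha_i)/2^i$. $f$ satisfies $\alpha$ if $f(\alpha)=1$. $\Theta^\models$ is the set of formulas satisfied by every valuation that satisfies every formula in $\Theta$. *)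

theory Defs
  imports Complex_Main
begin

text \<open>Formulas of infinitary Lukasiewicz logic with the countable-arity operator delta.
  Sequences alpha_1, alpha_2, ... are represented as functions nat => form,
  with alpha_(i+1) stored at index i.\<close>

datatype form = Var nat | Imp form form | Neg form | Delta "nat \<Rightarrow> form"

definition scons :: "form \<Rightarrow> (nat \<Rightarrow> form) \<Rightarrow> nat \<Rightarrow> form" where
  "scons a s = (\<lambda>n. if n = 0 then a else s (n - 1))"

definition half :: "form \<Rightarrow> form" where
  "half a = Delta (scons a (\<lambda>_. Neg (Imp a a)))"

definition Iff_ax :: "form \<Rightarrow> form \<Rightarrow> form set" where
  "Iff_ax a b = {Imp a b, Imp b a}"

inductive_set axioms :: "form set" where
  L1: "Imp a (Imp b a) \<in> axioms"
| L2: "Imp (Imp a b) (Imp (Imp b c) (Imp a c)) \<in> axioms"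
| L3: "Imp (Imp (Imp a b) b) (Imp (Imp b a) a) \<in> axioms"
| L4: "Imp (Imp (Neg a) (Neg b)) (Imp b a) \<in> axioms"
| D1: "\<phi> \<in> Iff_ax (Neg (Imp (Delta s) (half (s 0)))) (half (Delta (\<lambda>n. s (Suc n)))) \<Longrightarrow> \<phi> \<in> axioms"
| D2: "\<phi> \<in> Iff_ax (half (Delta s)) (Delta (\<lambda>n. half (s n))) \<Longrightarrow> \<phi> \<in> axioms"
| D3: "\<phi> \<in> Iff_ax (Delta (\<lambda>_. a)) a \<Longrightarrow> \<phi> \<in> axioms"
| D4: "\<phi> \<in> Iff_ax (half (Delta s)) (Delta (scons (Neg (Imp a a)) s)) \<Longrightarrow> \<phi> \<in> axioms"
| D5: "Imp (Delta s) (Delta (\<lambda>n. Imp (Neg (s n)) (t n))) \<in> axioms"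
| D6: "\<phi> \<in> Iff_ax (half (Neg (Imp a b))) (Neg (Imp (half a) (half b))) \<Longrightarrow> \<phi> \<in> axioms"
| D7: "Imp (Delta (\<lambda>n. Imp (s n) (t n))) (Imp (Delta s) (Delta t)) \<in> axioms"

text \<open>A proof is a sequence indexed by a countable successor ordinal.  We represent
  a countable well-ordered index set as a well-order r on a subset of nat (every
  countable ordinal is the order type of such an r); being a successor ordinal
  means having a greatest element, which carries the proved formula.\<close>

definition before :: "nat rel \<Rightarrow> nat \<Rightarrow> nat \<Rightarrow> bool" where
  "before r j i \<longleftrightarrow> (j, i) \<in> r \<and> j \<noteq> i"

definition is_proof :: "form set \<Rightarrow> nat rel \<Rightarrow> (nat \<Rightarrow> form) \<Rightarrow> form \<Rightarrow> bool" where
  "is_proof \<Theta> r p \<phi> \<longleftrightarrow>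
     well_order_on (Field r) r \<and>
     (\<exists>m \<in> Field r. (\<forall>i \<in> Field r. (i, m) \<in> r) \<and> p m = \<phi>) \<and>
     (\<forall>i \<in> Field r.
        p i \<in> axioms \<or> p i \<in> \<Theta> \<or>
        (\<exists>j k. before r j i \<and> before r k i \<and> p k = Imp (p j) (p i)) \<or>
        (\<exists>js :: nat \<Rightarrow> nat. (\<forall>n. before r (js n) i) \<and> p i = Delta (\<lambda>n. p (js n))))"

definition provable_set :: "form set \<Rightarrow> form set" where
  "provable_set \<Theta> = {\<phi>. \<exists>r p. is_proof \<Theta> r p \<phi>}"

definition valuation :: "(form \<Rightarrow> real) \<Rightarrow> bool" where
  "valuation f \<longleftrightarrow>
     (\<forall>a. 0 \<le> f a \<and> f a \<le> 1) \<and>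
     (\<forall>a. f (Neg a) = 1 - f a) \<and>
     (\<forall>a b. f (Imp a b) = min 1 (1 - f a + f b)) \<and>
     (\<forall>s. f (Delta s) = (\<Sum>n. f (s n) / 2 ^ Suc n))"

definition models_set :: "form set \<Rightarrow> form set" where
  "models_set \<Theta> = {\<phi>. \<forall>f. valuation f \<longrightarrow> (\<forall>\<psi> \<in> \<Theta>. f \<psi> = 1) \<longrightarrow> f \<phi> = 1}"

end

theory Submission
  imports Defs "HOL-Library.Nat_Bijection"
begin

text \<open>The Lindenbaum algebra is an MV-algebra (in Wajsberg's signature) with a halving operator.
  In it \<open>\<delta>\<close> enforces the Archimedean property: if \<open>\<not>\<phi>\<close> lies below \<open>2\<^sup>-\<^sup>n\<close> for every \<open>n\<close>, then
  \<open>\<phi>\<close> is derivable. Hence an underivable \<open>\<phi>\<close> has some \<open>n\<close> such that the implication from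
  \<open>1 - 2\<^sup>-\<^sup>n\<close> to \<open>\<phi>\<close> is underivable, and Zorn's lemma with prelinearity yields a prime filter
  missing it. Modulo a prime filter every element is either \<open>a/2\<close> or \<open>1/2 + a/2\<close>, so it has a
  binary expansion; reading it off gives a homomorphism to \<open>[0,1]\<close> with value at most
  \<open>1 - 2\<^sup>-\<^sup>n\<close> at \<open>\<phi>\<close>, and (\<open>\<Delta>1\<close>) forces it to respect \<open>\<delta>\<close>.\<close>

section \<open>Wajsberg algebras\<close>

locale wajsberg =
  fixes imp :: "'a \<Rightarrow> 'a \<Rightarrow> 'a" (infixr "\<rightarrow>" 65)
    and neg :: "'a \<Rightarrow> 'a" ("\<sim>_" [80] 80)
    and one :: 'a ("\<one>")
  assumes one_imp [simp]: "\<one> \<rightarrow> x = x"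
    and imp_chain: "(x \<rightarrow> y) \<rightarrow> ((y \<rightarrow> z) \<rightarrow> (x \<rightarrow> z)) = \<one>"
    and imp_swap: "(x \<rightarrow> y) \<rightarrow> y = (y \<rightarrow> x) \<rightarrow> x"
    and contrapos_le: "(\<sim>x \<rightarrow> \<sim>y) \<rightarrow> (y \<rightarrow> x) = \<one>"
begin

lemma imp_refl [simp]: "x \<rightarrow> x = \<one>"
  using imp_chain[of \<one> \<one> x] by simp

text \<open>\<open>imp_chain\<close> puts \<open>x\<close> below
  \<open>(x \<rightarrow> \<one>) \<rightarrow> \<one>\<close>, and \<open>imp_swap\<close>
  collapses that term to \<open>\<one>\<close>.\<close>

lemma imp_one [simp]: "x \<rightarrow> \<one> = \<one>"
  using imp_chain[of \<one> x \<one>] imp_swap[of x \<one>] by simp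

lemma imp_weaken [simp]: "x \<rightarrow> (y \<rightarrow> x) = \<one>"
  using imp_chain[of y \<one> x] by simp

lemma imp_antisym: "x \<rightarrow> y = \<one> \<Longrightarrow> y \<rightarrow> x = \<one> \<Longrightarrow> x = y"
  using imp_swap[of x y] by simp

lemma imp_trans: "x \<rightarrow> y = \<one> \<Longrightarrow> y \<rightarrow> z = \<one> \<Longrightarrow> x \<rightarrow> z = \<one>"
  using imp_chain[of x y z] by simp

lemma imp_antimono: "x \<rightarrow> y = \<one> \<Longrightarrow> (y \<rightarrow> z) \<rightarrow> (x \<rightarrow> z) = \<one>"
  using imp_chain[of x y z] by simp

lemma le_sup1 [simp]: "x \<rightarrow> ((x \<rightarrow> y) \<rightarrow> y) = \<one>"
  by (simp add: imp_swap[of x])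

text \<open>\<open>imp_chain\<close> bounds the left side by \<open>((y \<rightarrow> z)
  \<rightarrow> z) \<rightarrow> (x \<rightarrow> z)\<close>; since \<open>y\<close> lies below
  \<open>(y \<rightarrow> z) \<rightarrow> z\<close>, antitonicity finishes.\<close>

lemma imp_exchange_le: "(x \<rightarrow> (y \<rightarrow> z)) \<rightarrow> (y \<rightarrow> (x \<rightarrow> z)) = \<one>"
  by (rule imp_trans[OF imp_chain[of x "y \<rightarrow> z" z] imp_antimono]) simp

lemma imp_exchange: "x \<rightarrow> (y \<rightarrow> z) = y \<rightarrow> (x \<rightarrow> z)"
  by (rule imp_antisym; rule imp_exchange_le)

lemma imp_mono_le: "(y \<rightarrow> z) \<rightarrow> ((x \<rightarrow> y) \<rightarrow> (x \<rightarrow> z)) = \<one>"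
  using imp_chain[of x y z] by (simp only: imp_exchange[of "y \<rightarrow> z"])

lemma imp_mono: "y \<rightarrow> z = \<one> \<Longrightarrow> (x \<rightarrow> y) \<rightarrow> (x \<rightarrow> z) = \<one>"
  using imp_mono_le[of y z x] by simp

lemma neg_neg_le: "\<sim>\<sim>x \<rightarrow> x = \<one>"
proof -
  \<comment> \<open>\<open>\<sim>\<sim>x\<close> is first weakened to
    \<open>\<sim>\<sim>\<one> \<rightarrow> \<sim>\<sim>x\<close>; stripping a negation twice
    reverses this to \<open>\<one> \<rightarrow> x\<close>.\<close>
  have "\<sim>\<sim>x \<rightarrow> (\<sim>x \<rightarrow> \<sim>\<one>) = \<one>"
    by (rule imp_trans[OF imp_weaken[of _ "\<sim>\<sim>\<one>"] contrapos_le])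
  moreover have "(\<sim>x \<rightarrow> \<sim>\<one>) \<rightarrow> x = \<one>"
    using contrapos_le[of x \<one>] by simp
  ultimately show ?thesis by (rule imp_trans)
qed

lemma neg_neg [simp]: "\<sim>\<sim>x = x"
proof (rule imp_antisym[OF neg_neg_le])
  show "x \<rightarrow> \<sim>\<sim>x = \<one>"
    using contrapos_le[of "\<sim>\<sim>x" x] neg_neg_le[of "\<sim>x"] by simp
qed

lemma contrapos: "\<sim>x \<rightarrow> \<sim>y = y \<rightarrow> x"
  using imp_antisym[OF contrapos_le[of x y]] contrapos_le[of "\<sim>y" "\<sim>x"] by simp

lemma contrapos_neg1: "\<sim>x \<rightarrow> y = \<sim>y \<rightarrow> x"
  using contrapos[of x "\<sim>y"] by simp

lemma contrapos_neg2: "x \<rightarrow> \<sim>y = y \<rightarrow> \<sim>x"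
  using contrapos[of "\<sim>x" y] by simp

lemma zero_le [simp]: "\<sim>\<one> \<rightarrow> x = \<one>"
  using contrapos_neg1[of \<one> x] by simp

section \<open>The lattice join and prelinearity\<close>

definition sup :: "'a \<Rightarrow> 'a \<Rightarrow> 'a" (infixl "\<squnion>" 70)
  where "x \<squnion> y = (x \<rightarrow> y) \<rightarrow> y"

lemma sup_commute: "x \<squnion> y = y \<squnion> x"
  by (simp add: sup_def imp_swap)

lemma le_sup [simp]: "x \<rightarrow> x \<squnion> y = \<one>" "y \<rightarrow> x \<squnion> y = \<one>"
  by (simp_all add: sup_def)

text \<open>Applying antitonicity twice to \<open>x \<le> z\<close> gives
  \<open>x \<squnion> y \<le> z \<squnion> y\<close>, and \<open>z \<squnion> y\<close> equals
  \<open>z\<close> by \<open>imp_swap\<close>.\<close>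

lemma sup_least: "x \<rightarrow> z = \<one> \<Longrightarrow> y \<rightarrow> z = \<one> \<Longrightarrow> x \<squnion> y \<rightarrow> z = \<one>"
  using imp_antimono[OF imp_antimono, of x z y y] imp_swap[of z y]
  by (simp add: sup_def)

lemma sup_imp: "x \<squnion> y \<rightarrow> y = x \<rightarrow> y"
proof (rule imp_antisym)
  show "(x \<squnion> y \<rightarrow> y) \<rightarrow> (x \<rightarrow> y) = \<one>"
    by (rule imp_antimono) simp
  show "(x \<rightarrow> y) \<rightarrow> (x \<squnion> y \<rightarrow> y) = \<one>"
    by (simp add: sup_def)
qed

text \<open>With \<open>u\<close> and \<open>v\<close> the two implications, the goal reduces to
  \<open>u \<rightarrow> v = v\<close>. This comes from rewriting \<open>v\<close> as
  \<open>\<sim>x \<rightarrow> \<sim>y\<close> and expressing \<open>\<sim>y\<close> through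
  \<open>u\<close> and \<open>u \<rightarrow> y\<close>, which equals
  \<open>v \<rightarrow> x\<close>.\<close>

lemma prelinear: "(x \<rightarrow> y) \<squnion> (y \<rightarrow> x) = \<one>"
proof -
  define u where "u = x \<rightarrow> y"
  define v where "v = y \<rightarrow> x"
  have uv: "u \<rightarrow> y = v \<rightarrow> x"
    by (simp add: u_def v_def imp_swap)
  have "y \<rightarrow> u = \<one>" by (simp add: u_def)
  \<comment> \<open>The left side is the join of \<open>\<sim>y\<close> and \<open>\<sim>u\<close>,
    and \<open>\<sim>u\<close> lies below \<open>\<sim>y\<close>.\<close>
  then have "u \<rightarrow> \<sim>(u \<rightarrow> y) = \<sim>y"
    by (metis contrapos contrapos_neg2 imp_swap one_imp)
  then have "v = \<sim>x \<rightarrow> (u \<rightarrow> \<sim>(v \<rightarrow> x))"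
    by (simp add: uv v_def contrapos)
  also have "\<dots> = u \<rightarrow> (v \<rightarrow> x) \<rightarrow> x"
    by (simp add: imp_exchange[of "\<sim>x"] contrapos)
  also have "(v \<rightarrow> x) \<rightarrow> x = v"
    using sup_imp[of y x] by (simp add: v_def sup_def)
  finally have "u \<rightarrow> v = v" by simp
  then show ?thesis by (simp add: sup_def u_def v_def)
qed

text \<open>Needed so that, for a filter \<open>F\<close> and fixed \<open>r\<close>, the elements
  whose join with \<open>r\<close> lies in \<open>F\<close> are closed under detachment.\<close>

lemma sup_imp_sup: "((p \<rightarrow> q) \<squnion> r) \<rightarrow> (p \<squnion> r \<rightarrow> q \<squnion> r) = \<one>"
proof (rule sup_least)
  have "p \<squnion> r \<rightarrow> ((p \<rightarrow> q) \<rightarrow> q \<squnion> r) = \<one>"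
  proof (rule sup_least)
    show "p \<rightarrow> ((p \<rightarrow> q) \<rightarrow> q \<squnion> r) = \<one>"
      by (rule imp_trans[OF le_sup1 imp_mono]) simp
    show "r \<rightarrow> ((p \<rightarrow> q) \<rightarrow> q \<squnion> r) = \<one>"
      by (rule imp_trans[OF le_sup(2) imp_weaken])
  qed
  then show "(p \<rightarrow> q) \<rightarrow> (p \<squnion> r \<rightarrow> q \<squnion> r) = \<one>"
    by (simp add: imp_exchange[of "p \<rightarrow> q"])
  show "r \<rightarrow> (p \<squnion> r \<rightarrow> q \<squnion> r) = \<one>"
    by (rule imp_trans[OF le_sup(2) imp_weaken])
qed

text \<open>The term \<open>\<sim>x \<rightarrow> y\<close> is the truncated sum min(1, x + y); this
  is its associativity.\<close>

lemma oplus_assoc: "\<sim>(\<sim>x \<rightarrow> y) \<rightarrow> z = \<sim>x \<rightarrow> (\<sim>y \<rightarrow> z)"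
  using contrapos_neg1[of "\<sim>x \<rightarrow> y" z] contrapos_neg1[of z y] imp_exchange[of "\<sim>z" "\<sim>x" y]
  by simp

subsection \<open>Filters\<close>

definition filter :: "'a set \<Rightarrow> bool" where
  "filter F \<longleftrightarrow> \<one> \<in> F \<and> (\<forall>x y. x \<in> F \<longrightarrow> x \<rightarrow> y \<in> F \<longrightarrow> y \<in> F)"

inductive_set generated :: "'a set \<Rightarrow> 'a \<Rightarrow> 'a set" for F u where
  gen: "u \<in> generated F u"
| base: "x \<in> F \<Longrightarrow> x \<in> generated F u"
| mp: "x \<in> generated F u \<Longrightarrow> x \<rightarrow> y \<in> generated F u \<Longrightarrow> y \<in> generated F u"

lemma filter_one: "filter F \<Longrightarrow> \<one> \<in> F"
  by (simp add: filter_def)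

lemma filter_mp: "filter F \<Longrightarrow> x \<in> F \<Longrightarrow> x \<rightarrow> y \<in> F \<Longrightarrow> y \<in> F"
  unfolding filter_def by blast

lemma filter_up: "filter F \<Longrightarrow> x \<in> F \<Longrightarrow> x \<rightarrow> y = \<one> \<Longrightarrow> y \<in> F"
  using filter_mp[of F x y] filter_one[of F] by simp

lemma filter_generated: "filter F \<Longrightarrow> filter (generated F u)"
  unfolding filter_def by (blast intro: generated.base generated.mp)

text \<open>The elements whose join with \<open>v\<close> is in \<open>F\<close> form a filter
  containing \<open>F\<close> and \<open>u\<close>, hence all of
  \<open>generated F u\<close>.\<close>

lemma generated_sup:
  assumes F: "filter F" and "p \<in> generated F u" and "u \<squnion> v \<in> F"
  shows "p \<squnion> v \<in> F"
  using assms(2)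
proof induction
  case gen
  show ?case by fact
next
  case (base x)
  then show ?case using filter_up[OF F _ le_sup(1)] by simp
next
  case (mp x y)
  have "x \<squnion> v \<rightarrow> y \<squnion> v \<in> F"
    using filter_up[OF F mp.IH(2) sup_imp_sup] .
  then show ?case using filter_mp[OF F mp.IH(1)] by simp
qed

lemma generated_sup_generated:
  assumes F: "filter F" and p: "p \<in> generated F u" and q: "q \<in> generated F v"
    and uv: "u \<squnion> v \<in> F"
  shows "p \<squnion> q \<in> F"
  using generated_sup[OF F q, of p] generated_sup[OF F p uv] by (simp add: sup_commute)

definition prime_filter :: "'a set \<Rightarrow> bool" where
  "prime_filter F \<longleftrightarrow> filter F \<and> F \<noteq> UNIV \<and> (\<forall>x y. x \<rightarrow> y \<in> F \<or> y \<rightarrow> x \<in> F)"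

lemma prime_filter_extension:
  assumes G: "filter G" and p: "p \<notin> G"
  obtains F where "prime_filter F" "G \<subseteq> F" "p \<notin> F"
proof -
  define \<A> where "\<A> = {F. filter F \<and> G \<subseteq> F \<and> p \<notin> F}"
  have "\<exists>F\<in>\<A>. \<forall>X\<in>\<A>. F \<subseteq> X \<longrightarrow> X = F"
  proof (rule subset_Zorn_nonempty)
    show "\<A> \<noteq> {}" using assms by (auto simp: \<A>_def)
    fix \<C> assume ne: "\<C> \<noteq> {}" and ch: "subset.chain \<A> \<C>"
    have sub: "\<C> \<subseteq> \<A>" and tot: "\<And>X Y. X \<in> \<C> \<Longrightarrow> Y \<in> \<C> \<Longrightarrow> X \<subseteq> Y \<or> Y \<subseteq> X"
      using ch by (auto simp: subset_chain_def)
    have "filter (\<Union>\<C>)"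
      unfolding filter_def
    proof (intro conjI allI impI)
      show "\<one> \<in> \<Union>\<C>"
        using ne sub by (auto simp: \<A>_def intro: filter_one)
      fix x y assume "x \<in> \<Union>\<C>" "x \<rightarrow> y \<in> \<Union>\<C>"
      then obtain X Y where XY: "X \<in> \<C>" "Y \<in> \<C>" "x \<in> X" "x \<rightarrow> y \<in> Y" by blast
      \<comment> \<open>Of two comparable members of the chain, the larger contains both
        premises.\<close>
      then obtain Z where "Z \<in> \<C>" "x \<in> Z" "x \<rightarrow> y \<in> Z" using tot by blast
      moreover have "filter Z" using \<open>Z \<in> \<C>\<close> sub by (auto simp: \<A>_def)
      ultimately show "y \<in> \<Union>\<C>" using filter_mp by blast
    qed
    then show "\<Union>\<C> \<in> \<A>" using ne sub by (auto simp: \<A>_def)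
  qed
  then obtain F where F: "filter F" "G \<subseteq> F" "p \<notin> F"
    and max: "\<And>X. filter X \<Longrightarrow> G \<subseteq> X \<Longrightarrow> p \<notin> X \<Longrightarrow> F \<subseteq> X \<Longrightarrow> X = F"
    unfolding \<A>_def by auto
  have gen: "p \<in> generated F u" if "u \<notin> F" for u
  proof (rule ccontr)
    have "F \<subseteq> generated F u" by (auto intro: generated.base)
    moreover assume "p \<notin> generated F u"
    ultimately have "generated F u = F"
      using max[OF filter_generated[OF F(1)]] F(2) by blast
    with that generated.gen[of u F] show False by simp
  qed
  have "x \<rightarrow> y \<in> F \<or> y \<rightarrow> x \<in> F" for x y
  \<comment> \<open>By maximality each of the two missing implications generates \<open>p\<close>.
    Their join is \<open>\<one>\<close> by prelinearity, so \<open>p \<squnion> p\<close>, which is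
    \<open>p\<close>, would lie in \<open>F\<close>.\<close>
  proof (rule ccontr)
    assume "\<not> ?thesis"
    then have "p \<squnion> p \<in> F"
      using generated_sup_generated[OF F(1), of p "x \<rightarrow> y" p "y \<rightarrow> x"] gen
      by (simp add: prelinear filter_one[OF F(1)])
    then show False using F(3) by (simp add: sup_def)
  qed
  then show thesis
    using that[of F] F by (auto simp: prime_filter_def)
qed

end

section \<open>Algebras with halving\<close>

text \<open>Since \<open>\<sim>(x \<rightarrow> y)\<close> is the truncated difference max(0, x -
  y), the first two assumptions say that halving distributes over differences and that removing half
  of \<open>x\<close> leaves half of \<open>x\<close>.\<close>

locale halving = wajsberg +
  fixes h :: "'a \<Rightarrow> 'a"
  assumes h_diff: "h (\<sim>(x \<rightarrow> y)) = \<sim>(h x \<rightarrow> h y)"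
    and h_rest: "\<sim>(x \<rightarrow> h x) = h x"
    and h_le [simp]: "h x \<rightarrow> x = \<one>"
begin

abbreviation dbl :: "'a \<Rightarrow> 'a" where
  "dbl x \<equiv> \<sim>x \<rightarrow> x"

lemma neg_h_one: "\<sim>h \<one> = h \<one>"
  using h_rest[of \<one>] by simp

lemma dbl_h: "\<sim>h x \<rightarrow> h x = x"
proof -
  have "\<sim>h x = x \<rightarrow> h x"
    using h_rest[of x] neg_neg by metis
  then show ?thesis
    by (simp add: imp_swap[of x])
qed

text \<open>Contrapositive of \<open>h_le\<close> at the difference of \<open>x\<close> and
  \<open>y\<close>.\<close>

lemma h_mono_le: "(x \<rightarrow> y) \<rightarrow> (h x \<rightarrow> h y) = \<one>"
  using h_le[of "\<sim>(x \<rightarrow> y)"] contrapos by (simp add: h_diff)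

lemma h_mono: "x \<rightarrow> y = \<one> \<Longrightarrow> h x \<rightarrow> h y = \<one>"
  using h_mono_le[of x y] by simp

lemma h_le_half [simp]: "h x \<rightarrow> h \<one> = \<one>"
  by (rule h_mono) simp

lemma half_le_up: "h \<one> \<rightarrow> \<sim>h x = \<one>"
  using contrapos_neg2[of "h \<one>" "h x"] by (simp add: neg_h_one)

lemma h_zero: "h (\<sim>\<one>) = \<sim>\<one>"
  by (rule imp_antisym) simp_all

text \<open>Here \<open>h x\<close> is x/2 and \<open>\<sim>h (\<sim>x)\<close> is 1/2 + x/2. This
  lemma and the next ones compute implications between elements of these two shapes, the basis for
  removing a leading binary digit.\<close>

lemma h_imp_h: "h x \<rightarrow> h y = \<sim>h (\<sim>(x \<rightarrow> y))"
  by (simp add: h_diff)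

lemma up_imp_up: "\<sim>h (\<sim>x) \<rightarrow> \<sim>h (\<sim>y) = \<sim>h (\<sim>(x \<rightarrow> y))"
  by (simp add: contrapos h_imp_h)

lemma h_imp_up: "h x \<rightarrow> \<sim>h y = \<one>"
  by (rule imp_trans[OF h_le_half half_le_up])

lemma up_eq: "\<sim>h (\<sim>x) = h \<one> \<rightarrow> h x"
  by (simp add: h_imp_h)

text \<open>As \<open>y\<close> is below \<open>x\<close>, \<open>x\<close> equals
  \<open>(x \<rightarrow> y) \<rightarrow> y\<close>. Halving this with \<open>h_diff\<close> turns
  the left side into the join of \<open>h (x \<rightarrow> y)\<close> and \<open>h y\<close>, whose
  second member is the smaller.\<close>

lemma up_imp_h_ge:
  assumes "y \<rightarrow> x = \<one>"
  shows "\<sim>h (\<sim>x) \<rightarrow> h y = h (x \<rightarrow> y)"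
proof -
  have "(x \<rightarrow> y) \<rightarrow> y = x"
    using imp_swap[of x y] assms by simp
  then have "\<sim>h (\<sim>x) = h (x \<rightarrow> y) \<rightarrow> h y"
    using h_diff[of "x \<rightarrow> y" y] by simp
  moreover have "h y \<rightarrow> h (x \<rightarrow> y) = \<one>"
    by (rule h_mono) simp
  ultimately show ?thesis
    using imp_swap[of "h (x \<rightarrow> y)" "h y"] by simp
qed

lemma up_imp_h_le:
  assumes "x \<rightarrow> y = \<one>"
  shows "\<sim>h (\<sim>x) \<rightarrow> h y = \<sim>h (y \<rightarrow> x)"
proof -
  \<comment> \<open>\<open>w\<close> is the difference y - x. The sum of \<open>x\<close> and
    \<open>w\<close> does not overflow, so halving splits over it; half of \<open>x\<close> and half
    of \<open>\<sim>x\<close> then add up to \<open>h \<one>\<close>.\<close>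
  define w where "w = \<sim>(y \<rightarrow> x)"
  have "\<sim>x \<rightarrow> w = y"
    using imp_swap[of x y] assms by (simp add: w_def contrapos)
  moreover have "w \<rightarrow> \<sim>x = \<one>" by (simp add: w_def contrapos)
  ultimately have "h y = \<sim>h x \<rightarrow> h w"
    using up_imp_h_ge[of w "\<sim>x"] by simp
  then have "\<sim>h (\<sim>x) \<rightarrow> h y = \<sim>(\<sim>h (\<sim>x) \<rightarrow> h x) \<rightarrow> h w"
    by (simp add: oplus_assoc)
  also have "\<dots> = \<sim>h \<one> \<rightarrow> h w"
    by (simp add: up_imp_h_ge)
  also have "\<dots> = \<sim>h (\<sim>w)"
    by (simp add: up_eq neg_h_one)
  finally show ?thesis by (simp add: w_def)
qed

lemma h_dbl:
  assumes "x \<rightarrow> h \<one> = \<one>"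
  shows "h (dbl x) = x"
proof -
  have "x \<rightarrow> \<sim>x = \<one>"
    using imp_trans[OF assms, of "\<sim>x"] assms by (simp add: contrapos_neg2[of "h \<one>"] neg_h_one)
  then show ?thesis
    using up_imp_h_ge[of x "\<sim>x"] by (simp add: dbl_h)
qed

end

section \<open>Series with weights \<open>1 / 2 ^ Suc n\<close>\<close>

lemma binary_expansion:
  fixes g b :: "nat \<Rightarrow> real"
  assumes bounds: "\<And>n. 0 \<le> g n" "\<And>n. g n \<le> 1"
    and step: "\<And>n. g n = b n / 2 + g (Suc n) / 2"
  shows "(\<lambda>n. b n / 2 ^ Suc n) sums g 0"
proof -
  \<comment> \<open>Unfolding the recursion \<open>n\<close> times leaves the remainder g n / 2^n,
    which vanishes because \<open>g\<close> is bounded.\<close>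
  have partial: "(\<Sum>k<n. b k / 2 ^ Suc k) = g 0 - g n * (1 / 2) ^ n" for n
  proof (induction n)
    case (Suc n)
    then show ?case using step[of n] by (simp add: field_simps)
  qed simp
  have "(\<lambda>n. g n * (1 / 2) ^ n) \<longlonglongrightarrow> 0"
  proof (rule tendsto_sandwich)
    show "\<forall>\<^sub>F n in sequentially. 0 \<le> g n * (1 / 2) ^ n"
      using bounds by simp
    show "\<forall>\<^sub>F n in sequentially. g n * (1 / 2) ^ n \<le> (1 / 2) ^ n"
      using bounds by (intro always_eventually allI mult_left_le_one_le) auto
    show "(\<lambda>n. (1 / 2 :: real) ^ n) \<longlonglongrightarrow> 0"
      by (rule LIMSEQ_realpow_zero) auto
  qed simp
  then have "(\<lambda>n. g 0 - g n * (1 / 2) ^ n) \<longlonglongrightarrow> g 0 - 0"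
    by (intro tendsto_diff tendsto_const)
  then show ?thesis unfolding sums_def partial by simp
qed

lemma sums_halves: "(\<lambda>n. 1 / 2 ^ Suc n :: real) sums 1"
  by (rule binary_expansion[where g = "\<lambda>_. 1"]) auto

lemma le_of_le_power_half:
  fixes x :: real
  assumes "\<And>n. x \<le> (1 / 2) ^ n"
  shows "x \<le> 0"
  using LIMSEQ_le_const[OF LIMSEQ_realpow_zero[of "1 / 2 :: real"]] assms by auto

section \<open>Congruence modulo a filter\<close>

locale halving_filter = halving +
  fixes F
  assumes filter_F: "filter F"
begin

lemmas one_mem [simp] = filter_one[OF filter_F]
lemmas mp = filter_mp[OF filter_F]
lemmas up = filter_up[OF filter_F]

definition eqv :: "'a \<Rightarrow> 'a \<Rightarrow> bool" (infix "\<approx>" 50)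
  where "x \<approx> y \<longleftrightarrow> x \<rightarrow> y \<in> F \<and> y \<rightarrow> x \<in> F"

lemma le_trans: "x \<rightarrow> y \<in> F \<Longrightarrow> y \<rightarrow> z \<in> F \<Longrightarrow> x \<rightarrow> z \<in> F"
  using mp up imp_chain by metis

lemma eqv_sym: "x \<approx> y \<Longrightarrow> y \<approx> x"
  by (simp add: eqv_def)

lemma eqv_trans [trans]: "x \<approx> y \<Longrightarrow> y \<approx> z \<Longrightarrow> x \<approx> z"
  unfolding eqv_def using le_trans by blast

lemma eqv_neg: "x \<approx> y \<Longrightarrow> \<sim>x \<approx> \<sim>y"
  by (simp add: eqv_def contrapos)

lemma eqv_h: "x \<approx> y \<Longrightarrow> h x \<approx> h y"
  unfolding eqv_def using up[OF _ h_mono_le] by blast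

lemma eqv_imp_left: "x \<approx> x' \<Longrightarrow> x \<rightarrow> y \<approx> x' \<rightarrow> y"
  unfolding eqv_def using up[OF _ imp_chain] by blast

lemma eqv_imp_right: "y \<approx> y' \<Longrightarrow> x \<rightarrow> y \<approx> x \<rightarrow> y'"
  unfolding eqv_def using up[OF _ imp_mono_le] by blast

lemma eqv_imp: "x \<approx> x' \<Longrightarrow> y \<approx> y' \<Longrightarrow> x \<rightarrow> y \<approx> x' \<rightarrow> y'"
  using eqv_trans[OF eqv_imp_left eqv_imp_right] .

lemma mem_eqv: "x \<approx> y \<Longrightarrow> x \<in> F \<longleftrightarrow> y \<in> F"
  unfolding eqv_def using mp by blast

lemma eqv_one: "x \<approx> \<one> \<longleftrightarrow> x \<in> F"
  by (simp add: eqv_def)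

lemma eqv_mem_imp: "u \<in> F \<Longrightarrow> u \<rightarrow> z \<approx> z"
  by (simp add: eqv_def up[OF _ le_sup1])

lemma eqv_sup: "y \<rightarrow> x \<in> F \<Longrightarrow> x \<approx> x \<squnion> y"
  by (metis eqv_mem_imp eqv_sym sup_commute sup_def)

text \<open>By \<open>dbl_h\<close>, \<open>x\<close> is \<open>\<sim>h x \<rightarrow> h x\<close>;
  if the premise is in \<open>F\<close>, this is congruent to \<open>h x\<close>.\<close>

lemma neg_h_memD: "\<sim>h x \<in> F \<Longrightarrow> \<sim>x \<in> F"
proof -
  assume *: "\<sim>h x \<in> F"
  have "\<sim>h x \<rightarrow> h x \<approx> h x" using * by (rule eqv_mem_imp)
  then have "\<sim>h x \<approx> \<sim>x" using dbl_h[of x] by (metis eqv_neg eqv_sym)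
  then show ?thesis using * mem_eqv by blast
qed

lemma halving_below:
  assumes "x \<rightarrow> h \<one> \<in> F"
  obtains a where "x \<approx> h a"
proof -
  \<comment> \<open>\<open>m\<close> is the meet of \<open>x\<close> and \<open>h \<one>\<close>. It
    is congruent to \<open>x\<close>, but lies below \<open>h \<one>\<close> in the algebra itself,
    as \<open>h_dbl\<close> requires.\<close>
  define m where "m = \<sim>(\<sim>h \<one> \<squnion> \<sim>x)"
  have "m \<rightarrow> h \<one> = \<one>"
    using contrapos_neg1[of "\<sim>h \<one> \<squnion> \<sim>x" "h \<one>"] by (simp add: m_def)
  then have "h (dbl m) = m" by (rule h_dbl)
  moreover have "m \<approx> \<sim>\<sim>x"
    unfolding m_def sup_def contrapos by (intro eqv_neg eqv_mem_imp assms)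
  ultimately show thesis using that[of "dbl m"] eqv_sym by simp
qed

lemma h_dbl_eqv:
  assumes "x \<rightarrow> h \<one> \<in> F"
  shows "x \<approx> h (dbl x)"
proof -
  obtain a where a: "x \<approx> h a" using halving_below[OF assms] .
  then have "dbl x \<approx> dbl (h a)" by (intro eqv_imp eqv_neg)
  then have "h (dbl x) \<approx> h a" by (intro eqv_h) (simp add: dbl_h)
  with a show ?thesis using eqv_trans eqv_sym by blast
qed

lemma dbl_pow_mono: "x \<rightarrow> y \<in> F \<Longrightarrow> (dbl ^^ i) x \<rightarrow> (dbl ^^ i) y \<in> F"
proof (induction i)
  case (Suc i)
  let ?x = "(dbl ^^ i) x" and ?y = "(dbl ^^ i) y"
  have le: "?x \<rightarrow> ?y \<in> F" using Suc by simp
  have "dbl ?x \<rightarrow> (\<sim>?y \<rightarrow> ?x) \<in> F"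
    using up[OF _ imp_chain, of "\<sim>?y" "\<sim>?x"] le by (simp add: contrapos)
  moreover have "(\<sim>?y \<rightarrow> ?x) \<rightarrow> dbl ?y \<in> F"
    using up[OF le imp_mono_le] .
  ultimately show ?case using le_trans by simp
qed simp

lemma dbl_pow_h_pow: "(dbl ^^ i) ((h ^^ (i + k)) x) = (h ^^ k) x"
proof (induction i arbitrary: k)
  case (Suc i)
  then show ?case using Suc[of "Suc k"] by (simp add: dbl_h)
qed simp

text \<open>The bound with exponent \<open>i + 1\<close> keeps the \<open>i\<close>-fold double
  below one half, so the next doubling does not saturate and halving undoes it.\<close>

lemma infinitesimal_dbl_pow:
  assumes "\<And>n. x \<rightarrow> (h ^^ n) \<one> \<in> F"
  shows "(dbl ^^ i) x \<approx> h ((dbl ^^ Suc i) x)"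
  using h_dbl_eqv[of "(dbl ^^ i) x"] dbl_pow_mono[OF assms[of "i + 1"], of i]
    dbl_pow_h_pow[of i 1 \<one>]
  by simp

text \<open>In words of differences: y \<le> y - x with x \<le> y forces x = 0. The first premise is
  the join of \<open>\<sim>x\<close> and \<open>\<sim>y\<close>, and the second makes
  \<open>\<sim>x\<close> the larger member.\<close>

lemma neg_mem_of_absorb:
  assumes "y \<rightarrow> \<sim>(y \<rightarrow> x) \<in> F" and "x \<rightarrow> y \<in> F"
  shows "\<sim>x \<in> F"
proof -
  have "y \<rightarrow> \<sim>(y \<rightarrow> x) = \<sim>x \<squnion> \<sim>y"
    unfolding sup_def contrapos by (rule contrapos_neg2)
  moreover have "\<sim>x \<approx> \<sim>x \<squnion> \<sim>y"
    by (rule eqv_sup) (simp add: contrapos assms(2))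
  ultimately show ?thesis using assms(1) mem_eqv by simp
qed

end

section \<open>The real value of an element modulo a prime filter\<close>

locale prime_halving = halving_filter +
  assumes linear: "x \<rightarrow> y \<in> F \<or> y \<rightarrow> x \<in> F" and proper: "F \<noteq> UNIV"
begin

lemma half_not_mem: "h \<one> \<notin> F"
proof
  assume "h \<one> \<in> F"
  then have "\<sim>\<one> \<in> F" using neg_h_memD[of \<one>] by (simp add: neg_h_one)
  then have "x \<in> F" for x by (rule up) simp
  then show False using proper by blast
qed

lemma up_le_half: "\<sim>h (\<sim>x) \<rightarrow> h \<one> \<in> F \<Longrightarrow> \<sim>x \<in> F"
  using neg_h_memD[of x] by (simp add: up_imp_h_le)

lemma half_le_h: "h \<one> \<rightarrow> h x \<in> F \<Longrightarrow> x \<in> F"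
  using neg_h_memD[of "\<sim>x"] by (simp add: up_eq)

text \<open>The digit is 1 only strictly above one half, so \<open>h \<one>\<close> itself is
  expanded as 0.0111... in base two.\<close>

definition bit :: "'a \<Rightarrow> bool" where
  "bit x \<longleftrightarrow> x \<rightarrow> h \<one> \<notin> F"

text \<open>Deleting the leading digit: the two branches are 2x - 1 and 2x.\<close>

definition rest :: "'a \<Rightarrow> 'a" where
  "rest x = (if bit x then \<sim>dbl (\<sim>x) else dbl x)"

definition val :: "'a \<Rightarrow> real" where
  "val x = (\<Sum>n. of_bool (bit ((rest ^^ n) x)) / 2 ^ Suc n)"

lemma summable_val: "summable (\<lambda>n. of_bool (bit ((rest ^^ n) x)) / 2 ^ Suc n :: real)"
  by (rule summable_comparison_test'[OF sums_summable[OF sums_halves], of 0]) auto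

lemma val_nonneg [simp]: "0 \<le> val x"
  unfolding val_def by (rule suminf_nonneg[OF summable_val]) simp

lemma val_le_one [simp]: "val x \<le> 1"
  unfolding val_def
  by (rule sums_le[OF _ summable_sums[OF summable_val] sums_halves]) (simp add: divide_right_mono)

lemma val_rest: "val x = of_bool (bit x) / 2 + val (rest x) / 2"
proof -
  have "val x = of_bool (bit x) / 2 + (\<Sum>n. of_bool (bit ((rest ^^ Suc n) x)) / 2 ^ Suc (Suc n))"
    using suminf_split_head[OF summable_val[of x]] by (simp add: val_def)
  also have "(\<Sum>n. of_bool (bit ((rest ^^ Suc n) x)) / 2 ^ Suc (Suc n)) =
      (\<Sum>n. of_bool (bit ((rest ^^ n) (rest x))) / 2 ^ Suc n / 2 :: real)"
    by (simp add: funpow_swap1 field_simps)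
  also have "\<dots> = val (rest x) / 2"
    unfolding val_def by (rule suminf_divide[OF summable_val])
  finally show ?thesis .
qed

lemma bit_cong: "x \<approx> y \<Longrightarrow> bit x = bit y"
  using mem_eqv[OF eqv_imp_left] by (simp add: bit_def)

lemma rest_cong: "x \<approx> y \<Longrightarrow> rest x \<approx> rest y"
  by (simp add: rest_def bit_cong eqv_neg eqv_imp)

lemma val_cong:
  assumes "x \<approx> y"
  shows "val x = val y"
proof -
  have "(rest ^^ n) x \<approx> (rest ^^ n) y" for n
    by (induction n) (simp_all add: assms rest_cong)
  then have "bit ((rest ^^ n) x) = bit ((rest ^^ n) y)" for n by (rule bit_cong)
  then show ?thesis by (simp only: val_def)
qed

lemma val_h: "val (h x) = val x / 2"
proof -
  have "\<not> bit (h x)" by (simp add: bit_def)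
  then show ?thesis using val_rest[of "h x"] by (simp add: rest_def dbl_h)
qed

lemma val_one [simp]: "val \<one> = 1"
proof -
  have "bit \<one>" by (simp add: bit_def half_not_mem)
  then have "val \<one> = 1 / 2 + val \<one> / 2"
    using val_rest[of \<one>] by (simp add: rest_def)
  then show ?thesis by simp
qed

lemma val_zero [simp]: "val (\<sim>\<one>) = 0"
  using val_h[of "\<sim>\<one>"] by (simp add: h_zero)

lemma val_mem: "x \<in> F \<Longrightarrow> val x = 1"
  using val_cong[of x \<one>] by (simp add: eqv_one)

lemma val_neg_mem: "\<sim>x \<in> F \<Longrightarrow> val x = 0"
  using val_cong[OF eqv_neg, of "\<sim>x" \<one>] by (simp add: eqv_one)

lemma val_up: "val (\<sim>h (\<sim>x)) = 1 / 2 + val x / 2"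
proof (cases "bit (\<sim>h (\<sim>x))")
  case True
  then show ?thesis using val_rest[of "\<sim>h (\<sim>x)"] by (simp add: rest_def dbl_h)
next
  case False
  \<comment> \<open>Digit 0 is possible for 1/2 + x/2 only at the boundary: the element is then
    congruent to \<open>h \<one>\<close>, and \<open>x\<close> to zero.\<close>
  then have le: "\<sim>h (\<sim>x) \<rightarrow> h \<one> \<in> F" by (simp add: bit_def)
  then have "\<sim>h (\<sim>x) \<approx> h \<one>" by (simp add: eqv_def half_le_up)
  then have "val (\<sim>h (\<sim>x)) = 1 / 2" using val_cong val_h[of \<one>] by simp
  moreover have "val x = 0" using up_le_half[OF le] by (rule val_neg_mem)
  ultimately show ?thesis by simp
qed

text \<open>Linearity puts \<open>x\<close> or its complement below one half, where every element is
  a half; complementing gives the second shape.\<close>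

lemma halving_cases:
  obtains (low) a where "x \<approx> h a" | (high) a where "x \<approx> \<sim>h (\<sim>a)"
proof (cases "x \<rightarrow> h \<one> \<in> F")
  case True
  then show thesis using halving_below low by blast
next
  case False
  then have "\<sim>x \<rightarrow> h \<one> \<in> F"
    using linear[of x "h \<one>"] contrapos[of x "h \<one>"] by (simp add: neg_h_one)
  then obtain a where "\<sim>x \<approx> h a" using halving_below by blast
  then have "x \<approx> \<sim>h (\<sim>\<sim>a)" using eqv_neg[of "\<sim>x"] by simp
  then show thesis by (rule high)
qed

text \<open>Each homomorphism property is proved up to an error \<open>2\<^sup>-\<^sup>n\<close>, by induction on \<open>n\<close>:
  removing the leading binary digit of both arguments halves the error.\<close>

lemma val_mono_approx: "x \<rightarrow> y \<in> F \<Longrightarrow> val x - val y \<le> (1 / 2) ^ n"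
proof (induction n arbitrary: x y)
  case 0
  show ?case using val_le_one[of x] val_nonneg[of y] by (simp del: val_le_one val_nonneg)
next
  case (Suc n)
  show ?case
  proof (cases x rule: halving_cases)
    case x: (low a)
    show ?thesis
    proof (cases y rule: halving_cases)
      case y: (low b)
      have "h a \<rightarrow> h b \<in> F" using Suc.prems mem_eqv[OF eqv_imp[OF x y]] by simp
      then have "a \<rightarrow> b \<in> F" using neg_h_memD[of "\<sim>(a \<rightarrow> b)"] by (simp add: h_imp_h)
      from Suc.IH[OF this] show ?thesis
        by (simp add: val_cong[OF x] val_cong[OF y] val_h)
    next
      case y: (high b)
      have "val x - val y \<le> 0"
        using val_le_one[of a] val_nonneg[of b]
        by (simp add: val_cong[OF x] val_cong[OF y] val_h val_up del: val_le_one val_nonneg)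
      then show ?thesis by (rule order_trans) simp
    qed
  next
    case x: (high a)
    show ?thesis
    proof (cases y rule: halving_cases)
      case y: (low b)
      \<comment> \<open>Here 1/2 + a/2 \<le> b/2, so both sides equal one half: \<open>a\<close> has
        value 0 and \<open>b\<close> value 1.\<close>
      have le: "\<sim>h (\<sim>a) \<rightarrow> h b \<in> F" using Suc.prems mem_eqv[OF eqv_imp[OF x y]] by simp
      have "\<sim>h (\<sim>a) \<rightarrow> h \<one> \<in> F" by (rule le_trans[OF le]) simp
      then have "val a = 0" by (intro val_neg_mem up_le_half)
      moreover have "h \<one> \<rightarrow> h b \<in> F" by (rule le_trans[OF _ le]) (simp add: half_le_up)
      then have "val b = 1" by (rule val_mem[OF half_le_h])
      ultimately show ?thesis
        by (simp add: val_cong[OF x] val_cong[OF y] val_h val_up)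
    next
      case y: (high b)
      have "\<sim>h (\<sim>a) \<rightarrow> \<sim>h (\<sim>b) \<in> F" using Suc.prems mem_eqv[OF eqv_imp[OF x y]] by simp
      then have "a \<rightarrow> b \<in> F" using neg_h_memD[of "\<sim>(a \<rightarrow> b)"] by (simp add: up_imp_up)
      from Suc.IH[OF this] show ?thesis
        by (simp add: val_cong[OF x] val_cong[OF y] val_up)
    qed
  qed
qed

lemma val_mono: "x \<rightarrow> y \<in> F \<Longrightarrow> val x \<le> val y"
  using le_of_le_power_half[of "val x - val y"] val_mono_approx[of x y] by simp

lemma val_neg_approx: "\<bar>val (\<sim>x) - (1 - val x)\<bar> \<le> (1 / 2) ^ n"
proof (induction n arbitrary: x)
  case 0
  show ?case using val_le_one[of x] val_nonneg[of x] val_le_one[of "\<sim>x"] val_nonneg[of "\<sim>x"]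
    by (simp add: abs_le_iff del: val_le_one val_nonneg)
next
  case (Suc n)
  show ?case
  proof (cases x rule: halving_cases)
    case x: (low a)
    have "val (\<sim>x) = 1 / 2 + val (\<sim>a) / 2"
      using val_cong[OF eqv_neg[OF x]] val_up[of "\<sim>a"] by simp
    then show ?thesis using Suc[of a] by (simp add: val_cong[OF x] val_h abs_le_iff field_simps)
  next
    case x: (high a)
    have "val (\<sim>x) = val (\<sim>a) / 2"
      using val_cong[OF eqv_neg[OF x]] val_h[of "\<sim>a"] by simp
    then show ?thesis using Suc[of a] by (simp add: val_cong[OF x] val_up abs_le_iff field_simps)
  qed
qed

lemma val_neg: "val (\<sim>x) = 1 - val x"
  using le_of_le_power_half[of "\<bar>val (\<sim>x) - (1 - val x)\<bar>"] val_neg_approx[of x] by simp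

lemma val_imp_approx: "\<bar>val (x \<rightarrow> y) - min 1 (1 - val x + val y)\<bar> \<le> (1 / 2) ^ n"
proof (induction n arbitrary: x y)
  case 0
  show ?case using val_le_one[of x] val_nonneg[of x] val_le_one[of y] val_nonneg[of y]
      val_le_one[of "x \<rightarrow> y"] val_nonneg[of "x \<rightarrow> y"]
    by (simp add: abs_le_iff min_def del: val_le_one val_nonneg)
next
  case (Suc n)
  show ?case
  proof (cases x rule: halving_cases)
    case x: (low a)
    show ?thesis
    proof (cases y rule: halving_cases)
      case y: (low b)
      have "val (x \<rightarrow> y) = 1 / 2 + val (a \<rightarrow> b) / 2"
        using val_cong[OF eqv_imp[OF x y]] val_up[of "a \<rightarrow> b"] by (simp add: h_imp_h)
      then show ?thesis using Suc[of a b] val_cong[OF x] val_cong[OF y]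
        unfolding val_h val_up power_Suc by linarith
    next
      case y: (high b)
      have "val (x \<rightarrow> y) = 1"
        using val_cong[OF eqv_imp[OF x y]] by (simp add: h_imp_up)
      moreover have "val x \<le> val y"
        using val_le_one[of a] val_nonneg[of b]
        by (simp add: val_cong[OF x] val_cong[OF y] val_h val_up del: val_le_one val_nonneg)
      ultimately show ?thesis by simp
    qed
  next
    case x: (high a)
    show ?thesis
    proof (cases y rule: halving_cases)
      case y: (low b)
      show ?thesis
      proof (cases "b \<rightarrow> a \<in> F")
        case True
        \<comment> \<open>\<open>b\<close> is below \<open>a\<close> only modulo \<open>F\<close>.
          Replacing \<open>a\<close> by a congruent join makes the comparison exact, so that
          \<open>up_imp_h_ge\<close> applies; the other case treats \<open>b\<close>
          likewise.\<close>
        have "x \<approx> \<sim>h (\<sim>(a \<squnion> b))"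
          using x eqv_trans eqv_neg eqv_h eqv_sup[OF True] by blast
        from val_cong[OF eqv_imp[OF this y]] have "val (x \<rightarrow> y) = val (a \<rightarrow> b) / 2"
          by (simp add: up_imp_h_ge sup_imp val_h)
        then show ?thesis using Suc[of a b] val_mono[OF True] val_cong[OF x] val_cong[OF y]
        unfolding val_h val_up power_Suc by linarith
      next
        case False
        then have le: "a \<rightarrow> b \<in> F" using linear by blast
        have "y \<approx> h (b \<squnion> a)"
          using y eqv_trans eqv_h eqv_sup[OF le] by blast
        from val_cong[OF eqv_imp[OF x this]] have "val (x \<rightarrow> y) = val (\<sim>h (b \<rightarrow> a))"
          by (simp add: up_imp_h_le sup_imp)
        then have "val (x \<rightarrow> y) = 1 - val (b \<rightarrow> a) / 2"
          by (simp add: val_neg val_h)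
        then show ?thesis using Suc[of b a] val_mono[OF le] val_le_one[of b] val_nonneg[of a] val_cong[OF x] val_cong[OF y]
        unfolding val_h val_up power_Suc by linarith
      qed
    next
      case y: (high b)
      have "val (x \<rightarrow> y) = 1 / 2 + val (a \<rightarrow> b) / 2"
        using val_cong[OF eqv_imp[OF x y]] val_up[of "a \<rightarrow> b"] by (simp add: up_imp_up)
      then show ?thesis using Suc[of a b] val_cong[OF x] val_cong[OF y]
        unfolding val_h val_up power_Suc by linarith
    qed
  qed
qed

lemma val_imp: "val (x \<rightarrow> y) = min 1 (1 - val x + val y)"
  using le_of_le_power_half[of "\<bar>val (x \<rightarrow> y) - min 1 (1 - val x + val y)\<bar>"] val_imp_approx[of x y]
  by simp

lemma val_h_pow: "val ((h ^^ n) \<one>) = (1 / 2) ^ n"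
  by (induction n) (simp_all add: val_h)

end

section \<open>Derivability and soundness\<close>

text \<open>Derivability as a least closed set gives structural induction in place of transfinite
  proofs; \<open>provable_set_eq_der\<close> shows that the two notions agree.\<close>

inductive_set der :: "form set \<Rightarrow> form set" for \<Theta> where
  ax: "\<phi> \<in> axioms \<Longrightarrow> \<phi> \<in> der \<Theta>"
| hyp: "\<phi> \<in> \<Theta> \<Longrightarrow> \<phi> \<in> der \<Theta>"
| mp: "a \<in> der \<Theta> \<Longrightarrow> Imp a b \<in> der \<Theta> \<Longrightarrow> b \<in> der \<Theta>"
| delta: "(\<And>n. s n \<in> der \<Theta>) \<Longrightarrow> Delta s \<in> der \<Theta>"

lemma der_mono: "\<phi> \<in> der \<Theta> \<Longrightarrow> \<Theta> \<subseteq> \<Theta>' \<Longrightarrow> \<phi> \<in> der \<Theta>'"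
proof (induction rule: der.induct)
  case (mp a b)
  then show ?case using der.mp[of a \<Theta>' b] by simp
qed (simp_all add: der.ax der.hyp der.delta subsetD)

section \<open>Soundness: arithmetic of a valuation\<close>

context
  fixes f assumes f: "valuation f"
begin

lemma valuation_nonneg: "0 \<le> f a" and valuation_le_one: "f a \<le> 1"
  and valuation_Neg: "f (Neg a) = 1 - f a"
  and valuation_Imp: "f (Imp a b) = min 1 (1 - f a + f b)"
  using f by (auto simp: valuation_def)

lemma valuation_Delta_sums: "(\<lambda>n. f (s n) / 2 ^ Suc n) sums f (Delta s)"
proof -
  have "summable (\<lambda>n. f (s n) / 2 ^ Suc n)"
    by (rule summable_comparison_test'[OF sums_summable[OF sums_halves], of 0])
      (simp add: divide_right_mono valuation_nonneg valuation_le_one)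
  then show ?thesis using f by (simp add: valuation_def sums_iff)
qed

lemma valuation_Delta_split: "f (Delta s) = f (s 0) / 2 + f (Delta (\<lambda>n. s (Suc n))) / 2"
proof -
  have "(\<lambda>n. f (s (Suc n)) / 2 ^ Suc n / 2) sums (f (Delta (\<lambda>n. s (Suc n))) / 2)"
    by (rule sums_divide[OF valuation_Delta_sums])
  then have "(\<lambda>n. f (s (Suc n)) / 2 ^ Suc (Suc n)) sums (f (Delta (\<lambda>n. s (Suc n))) / 2)"
    by (simp add: field_simps)
  from sums_Suc[OF this] show ?thesis
    using sums_unique2[OF valuation_Delta_sums] by simp
qed

lemma valuation_Delta_const: "(\<And>n. f (s n) = c) \<Longrightarrow> f (Delta s) = c"
  using sums_unique2[OF valuation_Delta_sums[of s]] sums_mult[OF sums_halves, of c] by simp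

lemma valuation_Delta_mono: "(\<And>n. f (s n) \<le> f (t n)) \<Longrightarrow> f (Delta s) \<le> f (Delta t)"
  by (rule sums_le[OF _ valuation_Delta_sums valuation_Delta_sums]) (simp add: divide_right_mono)

lemma valuation_bot: "f (Neg (Imp a a)) = 0"
  by (simp add: valuation_Neg valuation_Imp)

lemma valuation_Delta_scons: "f (Delta (scons a s)) = f a / 2 + f (Delta s) / 2"
  using valuation_Delta_split[of "scons a s"] by (simp add: scons_def)

lemma valuation_half: "f (half a) = f a / 2"
  by (simp add: half_def valuation_Delta_scons valuation_Delta_const valuation_bot)

lemma valuation_Delta_half: "f (Delta (\<lambda>n. half (s n))) = f (Delta s) / 2"
  using sums_unique2[OF valuation_Delta_sums[of "\<lambda>n. half (s n)"]]
    sums_divide[OF valuation_Delta_sums[of s], of 2]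
  by (simp add: valuation_half field_simps)

text \<open>Termwise f(s \<rightarrow> t) + f(s) \<le> 1 + f(t), summed with weights of total 1. The
  additive form avoids the minimum and is what \<open>D7\<close> needs.\<close>

lemma valuation_Delta_Imp:
  "f (Delta (\<lambda>n. Imp (s n) (t n))) + f (Delta s) \<le> 1 + f (Delta t)"
proof (rule sums_le)
  show "(\<lambda>n. f (Imp (s n) (t n)) / 2 ^ Suc n + f (s n) / 2 ^ Suc n)
      sums (f (Delta (\<lambda>n. Imp (s n) (t n))) + f (Delta s))"
    by (intro sums_add valuation_Delta_sums)
  show "(\<lambda>n. 1 / 2 ^ Suc n + f (t n) / 2 ^ Suc n) sums (1 + f (Delta t))"
    by (intro sums_add valuation_Delta_sums sums_halves)
  show "f (Imp (s n) (t n)) / 2 ^ Suc n + f (s n) / 2 ^ Suc n \<le> 1 / 2 ^ Suc n + f (t n) / 2 ^ Suc n" for n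
    unfolding add_divide_distrib[symmetric]
    by (rule divide_right_mono) (auto simp: valuation_Imp min_def)
qed

lemma valuation_Iff_ax: "\<phi> \<in> Iff_ax a b \<Longrightarrow> f a = f b \<Longrightarrow> f \<phi> = 1"
  by (auto simp: Iff_ax_def valuation_Imp)

lemma valuation_axiom: "\<phi> \<in> axioms \<Longrightarrow> f \<phi> = 1"
proof (induction rule: axioms.induct)
  case (L1 a b)
  show ?case using valuation_le_one[of a] valuation_le_one[of b]
    unfolding valuation_Imp by linarith
next
  case (L2 a b c)
  show ?case unfolding valuation_Imp by linarith
next
  case (L3 a b)
  show ?case using valuation_le_one[of a] valuation_le_one[of b]
    unfolding valuation_Imp by linarith
next
  case (L4 a b)
  show ?case by (simp add: valuation_Imp valuation_Neg)
next
  \<comment> \<open>The tail is nonnegative, so the difference in the axiom is not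
    truncated.\<close>
  case (D1 \<phi> s)
  then show ?case
    by (rule valuation_Iff_ax)
      (use valuation_nonneg[of "Delta (\<lambda>n. s (Suc n))"] in
        \<open>simp add: valuation_Neg valuation_Imp valuation_half valuation_Delta_split[of s] min_def\<close>)
next
  case (D2 \<phi> s)
  then show ?case by (rule valuation_Iff_ax) (simp add: valuation_half valuation_Delta_half)
next
  case (D3 \<phi> a)
  then show ?case by (rule valuation_Iff_ax) (simp add: valuation_Delta_const)
next
  case (D4 \<phi> s a)
  then show ?case
    by (rule valuation_Iff_ax) (simp add: valuation_half valuation_Delta_scons valuation_bot)
next
  case (D5 s t)
  have "f (Delta s) \<le> f (Delta (\<lambda>n. Imp (Neg (s n)) (t n)))"
    by (rule valuation_Delta_mono)
      (simp add: valuation_Imp valuation_Neg valuation_nonneg valuation_le_one)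
  then show ?case by (simp add: valuation_Imp)
next
  case (D6 \<phi> a b)
  then show ?case
    by (rule valuation_Iff_ax) (simp add: valuation_half valuation_Neg valuation_Imp min_def)
next
  case (D7 s t)
  then show ?case using valuation_Delta_Imp[of s t] valuation_le_one[of "Delta (\<lambda>n. Imp (s n) (t n))"]
    by (simp add: valuation_Imp[of _ "Imp _ _"] valuation_Imp[of "Delta s"])
qed

lemma soundness:
  assumes "\<forall>\<psi>\<in>\<Theta>. f \<psi> = 1" and "\<phi> \<in> der \<Theta>"
  shows "f \<phi> = 1"
  using assms(2)
proof induction
  case (mp a b)
  then show ?case using valuation_le_one[of b] by (simp add: valuation_Imp)
qed (use assms(1) in \<open>auto simp: valuation_axiom valuation_Delta_const\<close>)

end

section \<open>Derivability and transfinite proofs\<close>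

lemma is_proof_imp_der:
  assumes "is_proof \<Theta> r p \<phi>"
  shows "\<phi> \<in> der \<Theta>"
proof -
  have wf: "wf (r - Id)"
    using assms by (auto simp: is_proof_def well_order_on_def)
  have "i \<in> Field r \<Longrightarrow> p i \<in> der \<Theta>" for i
  proof (induction i rule: wf_induct_rule[OF wf])
    case (1 i)
    have prev: "p j \<in> der \<Theta>" if "before r j i" for j
      using 1(1)[of j] that by (auto simp: before_def Field_def)
    have "p i \<in> axioms \<or> p i \<in> \<Theta> \<or>
        (\<exists>j k. before r j i \<and> before r k i \<and> p k = Imp (p j) (p i)) \<or>
        (\<exists>js. (\<forall>n. before r (js n) i) \<and> p i = Delta (\<lambda>n. p (js n)))"
      using assms 1(2) unfolding is_proof_def by blast
    then consider "p i \<in> axioms" | "p i \<in> \<Theta>"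
      | j k where "before r j i" "before r k i" "p k = Imp (p j) (p i)"
      | js where "\<And>n. before r (js n) i" "p i = Delta (\<lambda>n. p (js n))"
      by blast
    then show ?case
    proof cases
      case 3
      then show ?thesis using prev der.mp by metis
    next
      case 4
      then show ?thesis using prev der.delta[of "\<lambda>n. p (js n)"] by simp
    qed (simp_all add: der.ax der.hyp)
  qed
  then show ?thesis using assms unfolding is_proof_def by blast
qed

lemma is_proof_single: "\<phi> \<in> axioms \<or> \<phi> \<in> \<Theta> \<Longrightarrow> is_proof \<Theta> {(0, 0)} (\<lambda>_. \<phi>) \<phi>"
  by (auto simp: is_proof_def well_order_on_def linear_order_on_def partial_order_on_def
      preorder_on_def refl_on_def trans_def antisym_def total_on_def Field_def)

text \<open>The proofs with indices \<open>0, 1, 2, \<dots>\<close> are concatenated; \<open>node n i\<close> is step \<open>i\<close> of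
  the \<open>n\<close>-th one, and \<open>0\<close> is the new last step.\<close>

definition node :: "nat \<Rightarrow> nat \<Rightarrow> nat" where
  "node n i = Suc (prod_encode (n, i))"

lemma node_eq_iff [simp]: "node n i = node m j \<longleftrightarrow> n = m \<and> i = j"
  by (simp add: node_def)

lemma node_neq_zero [simp]: "node n i \<noteq> 0" "0 \<noteq> node n i"
  by (simp_all add: node_def)

text \<open>The ordinal sum of the orders \<open>r 0\<close>, \<open>r 1\<close>, ... with one
  further point on top.\<close>

definition concat_rel :: "(nat \<Rightarrow> nat rel) \<Rightarrow> nat rel" where
  "concat_rel r = {(node n i, node m j) | n i m j.
      i \<in> Field (r n) \<and> j \<in> Field (r m) \<and> (n < m \<or> n = m \<and> (i, j) \<in> r n)} \<union>
    {(node n i, 0) | n i. i \<in> Field (r n)} \<union> {(0, 0)}"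

definition concat_seq :: "(nat \<Rightarrow> nat \<Rightarrow> form) \<Rightarrow> form \<Rightarrow> nat \<Rightarrow> form" where
  "concat_seq p \<phi> x = (case x of 0 \<Rightarrow> \<phi> | Suc k \<Rightarrow> case_prod p (prod_decode k))"

lemma concat_seq_simps [simp]: "concat_seq p \<phi> 0 = \<phi>" "concat_seq p \<phi> (node n i) = p n i"
  by (simp_all add: concat_seq_def node_def)

lemma concat_rel_simps [simp]:
  "(node n i, node m j) \<in> concat_rel r \<longleftrightarrow>
    i \<in> Field (r n) \<and> j \<in> Field (r m) \<and> (n < m \<or> n = m \<and> (i, j) \<in> r n)"
  "(node n i, 0) \<in> concat_rel r \<longleftrightarrow> i \<in> Field (r n)"
  "(0, 0) \<in> concat_rel r"
  "(0, node n i) \<notin> concat_rel r"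
  by (auto simp: concat_rel_def)

lemma Field_concat_rel: "Field (concat_rel r) = insert 0 {node n i | n i. i \<in> Field (r n)}"
  by (fastforce simp: concat_rel_def Field_def)

lemma well_order_concat_rel:
  assumes wo: "\<And>n. well_order_on (Field (r n)) (r n)"
  shows "well_order_on (Field (concat_rel r)) (concat_rel r)"
proof -
  let ?R = "concat_rel r"
  have refl: "(i, i) \<in> r n" if "i \<in> Field (r n)" for n i
    using wo[of n] that
    by (auto simp: well_order_on_def linear_order_on_def partial_order_on_def preorder_on_def refl_on_def)
  have trans: "trans (r n)" and antisym: "antisym (r n)" and total: "total_on (Field (r n)) (r n)"
    and wf: "wf (r n - Id)" for n
    using wo[of n]
    by (auto simp: well_order_on_def linear_order_on_def partial_order_on_def preorder_on_def)
  have "refl_on (Field ?R) ?R"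
    by (auto simp: refl_on_def Field_concat_rel refl)
  moreover have "?R \<subseteq> Field ?R \<times> Field ?R"
    by (auto intro: FieldI1 FieldI2)
  moreover have "trans ?R"
  proof (rule transI)
    fix x y z assume xy: "(x, y) \<in> ?R" and yz: "(y, z) \<in> ?R"
    then have "x \<in> Field ?R" "y \<in> Field ?R" "z \<in> Field ?R"
      by (auto intro: FieldI1 FieldI2)
    then show "(x, z) \<in> ?R"
      using xy yz transD[OF trans] by (fastforce simp: Field_concat_rel)
  qed
  moreover have "antisym ?R"
  proof (rule antisymI)
    fix x y assume xy: "(x, y) \<in> ?R" and yx: "(y, x) \<in> ?R"
    then have "x \<in> Field ?R" "y \<in> Field ?R"
      by (auto intro: FieldI1 FieldI2)
    then show "x = y"
      using xy yx antisymD[OF antisym] by (auto simp: Field_concat_rel)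
  qed
  moreover have "total_on (Field ?R) ?R"
  proof (rule total_onI)
    fix x y assume "x \<in> Field ?R" "y \<in> Field ?R" "x \<noteq> y"
    then show "(x, y) \<in> ?R \<or> (y, x) \<in> ?R"
      using total unfolding total_on_def by (auto simp: Field_concat_rel) (metis nat_neq_iff)+
  qed
  moreover have "wf (?R - Id)"
  proof (rule wfI_min)
    fix x :: nat and Q assume x: "x \<in> Q"
    show "\<exists>z\<in>Q. \<forall>y. (y, z) \<in> ?R - Id \<longrightarrow> y \<notin> Q"
    proof (cases "\<exists>n i. node n i \<in> Q \<and> i \<in> Field (r n)")
      case False
      \<comment> \<open>Every strict predecessor is a node of some block, and no such node is in
        \<open>Q\<close>.\<close>
      have "y \<notin> Q" if "(y, x) \<in> ?R - Id" for y
        using that False x by (auto simp: concat_rel_def)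
      then show ?thesis using x by blast
    next
      case True
      \<comment> \<open>A minimal element of \<open>Q\<close> is found in the first block that meets
        \<open>Q\<close>, by well-foundedness inside that block.\<close>
      define n where "n = (LEAST n. \<exists>i. node n i \<in> Q \<and> i \<in> Field (r n))"
      have "\<exists>i. node n i \<in> Q \<and> i \<in> Field (r n)"
        unfolding n_def by (rule LeastI_ex) (use True in blast)
      define S where "S = {i. node n i \<in> Q \<and> i \<in> Field (r n)}"
      have "S \<noteq> {}"
        using \<open>\<exists>i. node n i \<in> Q \<and> i \<in> Field (r n)\<close> by (auto simp: S_def)
      then have "\<exists>i\<in>S. \<forall>j. (j, i) \<in> r n - Id \<longrightarrow> j \<notin> S"
        using wf[of n] unfolding wf_eq_minimal by blast
      then obtain i where i: "node n i \<in> Q" "i \<in> Field (r n)"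
        and min: "\<And>j. (j, i) \<in> r n - Id \<Longrightarrow> \<not> (node n j \<in> Q \<and> j \<in> Field (r n))"
        unfolding S_def by auto
      have "y \<notin> Q" if "(y, node n i) \<in> ?R - Id" for y
      proof -
        have "y \<in> Field ?R" using that by (auto intro: FieldI1)
        then show ?thesis
          using that min not_less_Least[of _ "\<lambda>n. \<exists>i. node n i \<in> Q \<and> i \<in> Field (r n)"]
          by (auto simp: Field_concat_rel n_def[symmetric])
      qed
      then show ?thesis using i by blast
    qed
  qed
  ultimately show ?thesis
    by (simp add: well_order_on_def linear_order_on_def partial_order_on_def preorder_on_def)
qed

lemma is_proof_concat:
  assumes proofs: "\<And>n. is_proof \<Theta> (r n) (p n) (\<psi> n)"
    and last: "(\<exists>n m. \<psi> m = Imp (\<psi> n) \<phi>) \<or> \<phi> = Delta \<psi>"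
  shows "is_proof \<Theta> (concat_rel r) (concat_seq p \<phi>) \<phi>"
proof -
  let ?R = "concat_rel r" and ?p = "concat_seq p \<phi>"
  have wo: "well_order_on (Field ?R) ?R"
    using proofs by (intro well_order_concat_rel) (simp add: is_proof_def)
  have max: "\<forall>x\<in>Field ?R. (x, 0) \<in> ?R"
    by (auto simp: Field_concat_rel)
  have "\<exists>m. m \<in> Field (r n) \<and> p n m = \<psi> n" for n
    using proofs[of n] unfolding is_proof_def by blast
  then obtain l where l: "\<And>n. l n \<in> Field (r n)" "\<And>n. p n (l n) = \<psi> n" by metis
  have before_zero: "before ?R (node n (l n)) 0" for n
    by (simp add: before_def l(1))
  have before_node: "before ?R (node n j) (node n i)" if "before (r n) j i" for n i j
    using that by (auto simp: before_def intro: FieldI1 FieldI2)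
  have step: "?p x \<in> axioms \<or> ?p x \<in> \<Theta> \<or>
        (\<exists>j k. before ?R j x \<and> before ?R k x \<and> ?p k = Imp (?p j) (?p x)) \<or>
        (\<exists>js. (\<forall>n. before ?R (js n) x) \<and> ?p x = Delta (\<lambda>n. ?p (js n)))"
    if x: "x \<in> Field ?R" for x
  proof (cases "x = 0")
    case True
    from last show ?thesis
    proof
      assume "\<exists>n m. \<psi> m = Imp (\<psi> n) \<phi>"
      then obtain n m where "\<psi> m = Imp (\<psi> n) \<phi>" by blast
      then have "?p (node m (l m)) = Imp (?p (node n (l n))) (?p x)" by (simp add: True l(2))
      then show ?thesis using before_zero True by blast
    next
      assume "\<phi> = Delta \<psi>"
      then have "?p x = Delta (\<lambda>n. ?p (node n (l n)))" by (simp add: True l(2))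
      then show ?thesis using before_zero True
        by (intro disjI2 exI[of _ "\<lambda>n. node n (l n)"]) simp
    qed
  next
    case False
    then obtain n i where ni: "x = node n i" "i \<in> Field (r n)"
      using x by (auto simp: Field_concat_rel)
    then have "p n i \<in> axioms \<or> p n i \<in> \<Theta> \<or>
        (\<exists>j k. before (r n) j i \<and> before (r n) k i \<and> p n k = Imp (p n j) (p n i)) \<or>
        (\<exists>js. (\<forall>k. before (r n) (js k) i) \<and> p n i = Delta (\<lambda>k. p n (js k)))"
      using proofs[of n] unfolding is_proof_def by blast
    then consider "p n i \<in> axioms" | "p n i \<in> \<Theta>"
      | j k where "before (r n) j i" "before (r n) k i" "p n k = Imp (p n j) (p n i)"
      | js where "\<And>k. before (r n) (js k) i" "p n i = Delta (\<lambda>k. p n (js k))"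
      by blast
    then show ?thesis
    proof cases
      case 3
      then have "?p (node n k) = Imp (?p (node n j)) (?p x)" by (simp add: ni)
      then show ?thesis using before_node 3 ni(1) by blast
    next
      case 4
      then have "?p x = Delta (\<lambda>k. ?p (node n (js k)))" by (simp add: ni)
      then show ?thesis using before_node 4(1) ni(1)
        by (intro disjI2 exI[of _ "\<lambda>k. node n (js k)"]) simp
    qed (simp_all add: ni)
  qed
  show ?thesis
    unfolding is_proof_def using wo max step by (auto simp: Field_concat_rel)
qed

lemma der_imp_is_proof: "\<phi> \<in> der \<Theta> \<Longrightarrow> \<exists>r p. is_proof \<Theta> r p \<phi>"
proof (induction rule: der.induct)
  case (ax \<phi>)
  then show ?case using is_proof_single by blast
next
  case (hyp \<phi>)
  then show ?case using is_proof_single by blast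
next
  case (mp a b)
  \<comment> \<open>Modus ponens has two premises; repeating the second one fills up the infinite
    family to be concatenated.\<close>
  let ?\<psi> = "\<lambda>n::nat. if n = 0 then a else Imp a b"
  have "\<exists>r p. is_proof \<Theta> r p (?\<psi> n)" for n using mp.IH by simp
  then obtain r p where rp: "\<And>n. is_proof \<Theta> (r n) (p n) (?\<psi> n)" by metis
  have "?\<psi> 1 = Imp (?\<psi> 0) b" by simp
  then show ?case using is_proof_concat[of \<Theta> r p ?\<psi> b, OF rp] by blast
next
  case (delta s)
  then obtain r p where "\<And>n. is_proof \<Theta> (r n) (p n) (s n)" by metis
  then show ?case using is_proof_concat[of \<Theta> r p s "Delta s"] by blast
qed

lemma provable_set_eq_der: "provable_set \<Theta> = der \<Theta>"
  using is_proof_imp_der der_imp_is_proof by (fastforce simp: provable_set_def)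

section \<open>The Lindenbaum algebra\<close>

lemma der_axiom [intro]:
  "Imp a (Imp b a) \<in> der \<Theta>"
  "Imp (Imp a b) (Imp (Imp b c) (Imp a c)) \<in> der \<Theta>"
  "Imp (Imp (Imp a b) b) (Imp (Imp b a) a) \<in> der \<Theta>"
  "Imp (Imp (Neg a) (Neg b)) (Imp b a) \<in> der \<Theta>"
  by (auto intro: der.ax axioms.intros)

lemma der_weaken: "b \<in> der \<Theta> \<Longrightarrow> Imp a b \<in> der \<Theta>"
  by (rule der.mp[OF _ der_axiom(1)])

lemma der_trans: "Imp a b \<in> der \<Theta> \<Longrightarrow> Imp b c \<in> der \<Theta> \<Longrightarrow> Imp a c \<in> der \<Theta>"
  by (rule der.mp[OF _ der.mp[OF _ der_axiom(2)]])

text \<open>\<open>L3\<close> turns \<open>Imp (Imp a t) t\<close>, a weakening of \<open>t\<close>,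
  into the conclusion.\<close>

lemma der_detach:
  assumes "t \<in> der \<Theta>"
  shows "Imp (Imp t a) a \<in> der \<Theta>"
  by (rule der.mp[OF der_weaken[OF assms] der_axiom(3)])

lemma der_refl: "Imp a a \<in> der \<Theta>"
  by (rule der_trans[OF der_axiom(1)[of a "Imp a (Imp a a)"] der_detach]) (rule der_axiom(1))

lemma der_dne: "Imp (Neg (Neg a)) a \<in> der \<Theta>"
proof -
  let ?t = "Imp a a"
  have "Imp (Neg (Neg a)) (Imp (Neg (Neg ?t)) (Neg (Neg a))) \<in> der \<Theta>" ..
  moreover have "Imp (Imp (Neg (Neg ?t)) (Neg (Neg a))) (Imp (Neg a) (Neg ?t)) \<in> der \<Theta>" ..
  moreover have "Imp (Imp (Neg a) (Neg ?t)) (Imp ?t a) \<in> der \<Theta>" ..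
  moreover have "Imp (Imp ?t a) a \<in> der \<Theta>" by (rule der_detach[OF der_refl])
  ultimately show ?thesis by (blast intro: der_trans)
qed

lemma der_dni: "Imp a (Neg (Neg a)) \<in> der \<Theta>"
  by (rule der.mp[OF der_dne der_axiom(4)])

lemma der_contrapos: "Imp a b \<in> der \<Theta> \<Longrightarrow> Imp (Neg b) (Neg a) \<in> der \<Theta>"
  by (rule der.mp[OF der_trans[OF der_trans[OF der_dne] der_dni] der_axiom(4)])

lemma der_exfalso: "Imp (Neg (Imp a a)) b \<in> der \<Theta>"
  by (rule der.mp[OF der_weaken der_axiom(4)]) (rule der.mp[OF der_refl der_dni])

lemma der_imp_mono:
  assumes "Imp a' a \<in> der \<Theta>" and "Imp b b' \<in> der \<Theta>"
  shows "Imp (Imp a b) (Imp a' b') \<in> der \<Theta>"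
proof (rule der_trans)
  show "Imp (Imp a b) (Imp a' b) \<in> der \<Theta>"
    by (rule der.mp[OF assms(1) der_axiom(2)])
  \<comment> \<open>\<open>L2\<close> yields the conclusion under the extra premise
    \<open>Imp b b'\<close>, which \<open>der_detach\<close> discharges.\<close>
  show "Imp (Imp a' b) (Imp a' b') \<in> der \<Theta>"
    by (rule der_trans[OF der_axiom(2) der_detach[OF assms(2)]])
qed

text \<open>The infinitary rule collects all the implications into the antecedent of
  \<open>D7\<close>.\<close>

lemma der_Delta_mono:
  assumes "\<And>n. Imp (s n) (t n) \<in> der \<Theta>"
  shows "Imp (Delta s) (Delta t) \<in> der \<Theta>"
  by (rule der.mp[OF der.delta[of "\<lambda>n. Imp (s n) (t n)"]]) (auto intro: assms der.ax axioms.D7)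

lemma der_half_mono:
  assumes "Imp a b \<in> der \<Theta>"
  shows "Imp (half a) (half b) \<in> der \<Theta>"
  unfolding half_def by (rule der_Delta_mono) (simp add: scons_def assms der_exfalso)

text \<open>\<open>half (s 0)\<close> is the delta of \<open>s 0\<close> followed by falsities, so
  it lies termwise below \<open>s\<close>.\<close>

lemma der_half_le_Delta: "Imp (half (s 0)) (Delta s) \<in> der \<Theta>"
  unfolding half_def by (rule der_Delta_mono) (simp add: scons_def der_refl der_exfalso)

lemma der_Iff_ax:
  assumes "\<And>\<phi>. \<phi> \<in> Iff_ax a b \<Longrightarrow> \<phi> \<in> axioms"
  shows "Imp a b \<in> der \<Theta>" "Imp b a \<in> der \<Theta>"
  by (rule der.ax, rule assms, simp add: Iff_ax_def)+

definition equiv_form :: "form \<Rightarrow> form \<Rightarrow> bool" where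
  "equiv_form a b \<longleftrightarrow> Imp a b \<in> der {} \<and> Imp b a \<in> der {}"

quotient_type lind = form / equiv_form
proof (rule equivpI)
  show "reflp equiv_form" by (simp add: reflp_def equiv_form_def der_refl)
  show "symp equiv_form" by (simp add: symp_def equiv_form_def)
  show "transp equiv_form" unfolding transp_def equiv_form_def using der_trans by blast
qed

lift_definition limp :: "lind \<Rightarrow> lind \<Rightarrow> lind" is Imp
  by (simp add: equiv_form_def der_imp_mono)

lift_definition lneg :: "lind \<Rightarrow> lind" is Neg
  by (simp add: equiv_form_def der_contrapos)

lift_definition lone :: lind is "Imp (Var 0) (Var 0)" .

lift_definition lhalf :: "lind \<Rightarrow> lind" is half
  by (simp add: equiv_form_def der_half_mono)

lemma abs_lind_eq_iff: "abs_lind a = abs_lind b \<longleftrightarrow> Imp a b \<in> der {} \<and> Imp b a \<in> der {}"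
  by (simp add: lind.abs_eq_iff equiv_form_def)

lemma abs_lind_Imp: "abs_lind (Imp a b) = limp (abs_lind a) (abs_lind b)"
  by (simp add: limp.abs_eq)

lemma abs_lind_Neg: "abs_lind (Neg a) = lneg (abs_lind a)"
  by (simp add: lneg.abs_eq)

lemma abs_lind_half: "abs_lind (half a) = lhalf (abs_lind a)"
  by (simp add: lhalf.abs_eq)

lemmas abs_lind_hom = abs_lind_Imp abs_lind_Neg abs_lind_half

lemma abs_lind_one: "abs_lind a = lone \<longleftrightarrow> a \<in> der {}"
  unfolding lone_def abs_lind_eq_iff map_fun_apply id_apply
  using der_refl der_weaken der.mp by blast

lemma lind_Iff_ax:
  assumes "\<And>\<phi>. \<phi> \<in> Iff_ax a b \<Longrightarrow> \<phi> \<in> axioms"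
  shows "abs_lind a = abs_lind b"
  unfolding abs_lind_eq_iff using der_Iff_ax[OF assms] by blast

lemma lind_Delta_const: "abs_lind (Delta (\<lambda>_. a)) = abs_lind a"
  by (rule lind_Iff_ax) (rule axioms.D3)

lemma lind_Delta_diff:
  "lneg (limp (abs_lind (Delta s)) (lhalf (abs_lind (s 0)))) = lhalf (abs_lind (Delta (\<lambda>n. s (Suc n))))"
  unfolding abs_lind_hom[symmetric] by (rule lind_Iff_ax) (rule axioms.D1)

lemma lind_half_Delta: "lhalf (abs_lind (Delta s)) = abs_lind (Delta (\<lambda>n. half (s n)))"
  unfolding abs_lind_hom[symmetric] by (rule lind_Iff_ax) (rule axioms.D2)

lemma lind_half_le_Delta: "limp (lhalf (abs_lind (s 0))) (abs_lind (Delta s)) = lone"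
  unfolding abs_lind_hom[symmetric] abs_lind_one by (rule der_half_le_Delta)

lemma abs_lind_surj: "\<exists>a. x = abs_lind a"
  by (induction x rule: lind.abs_induct) blast

interpretation lind: halving limp lneg lone lhalf
proof
  fix x y z :: lind
  obtain a b c where abc: "x = abs_lind a" "y = abs_lind b" "z = abs_lind c"
    using abs_lind_surj by metis
  show "limp lone x = x"
  proof -
    have t: "abs_lind (Imp a a) = lone" by (simp add: abs_lind_one der_refl)
    show ?thesis
      unfolding abc t[symmetric] abs_lind_hom(1)[symmetric] abs_lind_eq_iff
      using der_detach[OF der_refl] der_axiom(1) by blast
  qed
  show "limp (limp x y) (limp (limp y z) (limp x z)) = lone"
    unfolding abc abs_lind_hom[symmetric] abs_lind_one ..
  show "limp (limp x y) y = limp (limp y x) x"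
    unfolding abc abs_lind_hom[symmetric] abs_lind_eq_iff by blast
  show "limp (limp (lneg x) (lneg y)) (limp y x) = lone"
    unfolding abc abs_lind_hom[symmetric] abs_lind_one ..
  show "lhalf (lneg (limp x y)) = lneg (limp (lhalf x) (lhalf y))"
    unfolding abc abs_lind_hom[symmetric] by (rule lind_Iff_ax) (rule axioms.D6)
  \<comment> \<open>For a constant sequence, \<open>D3\<close> removes both deltas from
    \<open>D1\<close>.\<close>
  show "lneg (limp x (lhalf x)) = lhalf x"
    using lind_Delta_diff[of "\<lambda>_. a"] by (simp add: abc lind_Delta_const)
  show "limp (lhalf x) x = lone"
    using lind_half_le_Delta[of "\<lambda>_. a"] by (simp add: abc lind_Delta_const)
qed

section \<open>Completeness\<close>

lemma abs_lind_der_iff: "abs_lind a \<in> abs_lind ` der \<Theta> \<longleftrightarrow> a \<in> der \<Theta>"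
proof
  assume "abs_lind a \<in> abs_lind ` der \<Theta>"
  then obtain b where "b \<in> der \<Theta>" "abs_lind a = abs_lind b" by blast
  then show "a \<in> der \<Theta>"
    using der.mp[of b \<Theta> a] der_mono[of _ "{}" \<Theta>] by (auto simp: abs_lind_eq_iff)
qed blast

lemma filter_der: "lind.filter (abs_lind ` der \<Theta>)"
  unfolding lind.filter_def
proof (intro conjI allI impI)
  show "lone \<in> abs_lind ` der \<Theta>"
    using der_refl abs_lind_one image_eqI by metis
  fix x y assume *: "x \<in> abs_lind ` der \<Theta>" "limp x y \<in> abs_lind ` der \<Theta>"
  obtain a b where ab: "x = abs_lind a" "y = abs_lind b"
    using abs_lind_surj by metis
  show "y \<in> abs_lind ` der \<Theta>"
    using * der.mp[of a \<Theta> b] unfolding ab abs_lind_hom[symmetric] abs_lind_der_iff by blast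
qed

text \<open>An infinitesimal \<open>x\<close> vanishes: the sequence \<open>2x, 4x, 8x, \<dots>\<close> never saturates, and its
  \<open>\<delta>\<close>-value \<open>y\<close>, formally \<open>x + x + x + \<dots>\<close>, satisfies \<open>y - x = y\<close>.\<close>

lemma der_archimedean:
  assumes "\<And>n. limp (lneg ((lhalf ^^ n) lone)) (abs_lind \<phi>) \<in> abs_lind ` der \<Theta>"
  shows "\<phi> \<in> der \<Theta>"
proof -
  let ?G = "abs_lind ` der \<Theta>"
  interpret G: halving_filter limp lneg lone lhalf ?G
    by unfold_locales (rule filter_der)
  define x where "x = abs_lind (Neg \<phi>)"
  \<comment> \<open>\<open>z i\<close> is a formula for the \<open>i\<close>-fold truncated double
    of \<open>Neg \<phi>\<close>; \<open>Delta\<close> needs formulas rather than their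
    classes.\<close>
  define z where "z i = ((\<lambda>a. Imp (Neg a) a) ^^ i) (Neg \<phi>)" for i
  have abs_z: "abs_lind (z i) = (lind.dbl ^^ i) x" for i
    by (induction i) (simp_all add: z_def x_def abs_lind_hom)
  have "limp x ((lhalf ^^ n) lone) \<in> ?G" for n
    using assms[of n] unfolding x_def abs_lind_Neg lind.contrapos_neg1[of _ "abs_lind \<phi>"] .
  then have z_half: "G.eqv (abs_lind (z i)) (lhalf (abs_lind (z (Suc i))))" for i
    unfolding abs_z by (rule G.infinitesimal_dbl_pow)
  define y where "y = abs_lind (Delta (\<lambda>n. z (Suc n)))"
  have "Imp (z (Suc n)) (half (z (Suc (Suc n)))) \<in> der \<Theta>" for n
    using z_half[of "Suc n"] unfolding G.eqv_def abs_lind_hom[symmetric] abs_lind_der_iff by blast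
  then have "Imp (Delta (\<lambda>n. z (Suc n))) (Delta (\<lambda>n. half (z (Suc (Suc n))))) \<in> der \<Theta>"
    by (rule der_Delta_mono)
  \<comment> \<open>By \<open>D2\<close> and \<open>D1\<close>, the delta of the halved shifted
    sequence is y minus half of \<open>z 1\<close>, and half of \<open>z 1\<close> is congruent to
    \<open>x\<close>. So y \<le> y - x modulo the filter.\<close>
  then have "limp y (lneg (limp y (lhalf (abs_lind (z 1))))) \<in> ?G"
    using lind_Delta_diff[of "\<lambda>n. z (Suc n)"] lind_half_Delta[of "\<lambda>n. z (Suc (Suc n))"]
    by (simp add: y_def abs_lind_Imp[symmetric] abs_lind_der_iff)
  moreover have "limp (lhalf (abs_lind (z 1))) y \<in> ?G"
    using lind_half_le_Delta[of "\<lambda>n. z (Suc n)"] G.one_mem by (simp add: y_def)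
  ultimately have "lneg (lhalf (abs_lind (z 1))) \<in> ?G"
    by (rule G.neg_mem_of_absorb)
  then have "lneg x \<in> ?G"
    using G.mem_eqv[OF G.eqv_neg[OF z_half[of 0]]] abs_z[of 0] by simp
  then show ?thesis
    by (simp add: x_def abs_lind_hom abs_lind_der_iff)
qed

lemma completeness:
  assumes "\<phi> \<notin> der \<Theta>"
  obtains f where "valuation f" "\<forall>\<psi>\<in>\<Theta>. f \<psi> = 1" "f \<phi> \<noteq> 1"
proof -
  obtain n where "limp (lneg ((lhalf ^^ n) lone)) (abs_lind \<phi>) \<notin> abs_lind ` der \<Theta>"
    using assms der_archimedean by blast
  then obtain F where F: "lind.prime_filter F" and sub: "abs_lind ` der \<Theta> \<subseteq> F"
    and notin: "limp (lneg ((lhalf ^^ n) lone)) (abs_lind \<phi>) \<notin> F"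
    by (rule lind.prime_filter_extension[OF filter_der])
  interpret F: prime_halving limp lneg lone lhalf F
    by unfold_locales (use F in \<open>unfold lind.prime_filter_def, blast\<close>)+
  define f where "f a = F.val (abs_lind a)" for a
  have f_split: "f (Delta s) = f (s 0) / 2 + f (Delta (\<lambda>n. s (Suc n))) / 2" for s
  proof -
    \<comment> \<open>\<open>D1\<close> only determines the truncated difference; this bound shows
      that nothing is cut off.\<close>
    have "f (s 0) / 2 \<le> f (Delta s)"
      using F.val_mono[of "lhalf (abs_lind (s 0))" "abs_lind (Delta s)"]
      by (simp add: f_def lind_half_le_Delta F.val_h)
    moreover have "1 - min 1 (1 - f (Delta s) + f (s 0) / 2) = f (Delta (\<lambda>n. s (Suc n))) / 2"
      using arg_cong[OF lind_Delta_diff[of s], of F.val]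
      by (simp add: f_def F.val_neg F.val_imp F.val_h)
    ultimately show ?thesis by linarith
  qed
  have f_Delta: "f (Delta s) = (\<Sum>n. f (s n) / 2 ^ Suc n)" for s
  proof -
    \<comment> \<open>\<open>binary_expansion\<close> is applied to the values of the tails of
      \<open>s\<close>; writing \<open>0 + k\<close> exhibits the whole sequence as tail number
      0.\<close>
    have "(\<lambda>n. f (s n) / 2 ^ Suc n) sums f (Delta (\<lambda>k. s (0 + k)))"
    proof (rule binary_expansion)
      show "f (Delta (\<lambda>k. s (n + k))) = f (s n) / 2 + f (Delta (\<lambda>k. s (Suc n + k))) / 2" for n
        using f_split[of "\<lambda>k. s (n + k)"] by simp
    qed (simp_all add: f_def)
    then show ?thesis by (simp add: sums_iff)
  qed
  have "valuation f"
    unfolding valuation_def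
    by (simp add: f_Delta) (simp add: f_def abs_lind_hom F.val_neg F.val_imp)
  moreover have "\<forall>\<psi>\<in>\<Theta>. f \<psi> = 1"
    using sub by (auto simp: f_def intro!: F.val_mem der.hyp)
  \<comment> \<open>Since the implication from 1 - 2^-n to \<open>\<phi>\<close> is missing from the
    prime filter, the reverse one belongs to it, and \<open>val\<close> is monotone.\<close>
  moreover have "f \<phi> \<le> 1 - (1 / 2) ^ n"
    using F.linear[of "abs_lind \<phi>" "lneg ((lhalf ^^ n) lone)"] notin F.val_mono
    by (metis F.val_h_pow F.val_neg f_def)
  then have "f \<phi> \<noteq> 1"
    using zero_less_power[of "1 / 2 :: real" n] by linarith
  ultimately show thesis by (rule that)
qed

theorem mainTheorem13:
  fixes \<Theta> :: "form set"
  shows "provable_set \<Theta> = models_set \<Theta>"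
proof (intro set_eqI iffI)
  fix \<phi>
  assume "\<phi> \<in> provable_set \<Theta>"
  then show "\<phi> \<in> models_set \<Theta>"
    using soundness by (auto simp: provable_set_eq_der models_set_def)
next
  fix \<phi>
  assume "\<phi> \<in> models_set \<Theta>"
  then show "\<phi> \<in> provable_set \<Theta>"
    unfolding provable_set_eq_der models_set_def using completeness by blast
qed

end
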